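(* Let $\ell\in\mathbb{N}=\{1,2,\dots\}$ and $p>1$ be real. Set $$B_p^{(\ell)}:=\left(\left(\tfrac{p-1}{p}\right)_{\ell}\right)^{p}=\left(\prod_{j=0}^{\ell-1}\left(\tfrac{p-1}{p}+j\right)\right)^{p}.$$ Then for every finitely supported complex sequence $u=(u_n)_{n\in\mathbb{N}_0}$ such that $u_n=0$ for all $n<\ell$, the inequality $$\sum_{n=\ell}^{\infty}\left|\nabla^{\ell}u_n\right|^{p}\;\ge\;B_p^{(\ell)}\sum_{n=\ell}^{\infty}\frac{|u_n|^{p}}{n^{\ell p}}$$ holds. Moreover, the constant $B_p^{(\ell)}$ is optimal, i.e. if a real number $B$ is such that $\sum_{n=\ell}^{\infty}|\nabla^{\ell}u_n|^{p}\ge B\sum_{n=\ell}^{\infty}|u_n|^{p}/n^{\ell p}$ for all such $u$, then $B\le B_p^{(\ell)}$.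
   Context: $\mathbb{N}_0=\{0,1,2,\dots\}$. The discrete gradient $\nabla$ acts on complex sequences indexed by $\mathbb{N}_0$ by $\nabla u_n:=u_n-u_{n-1}$, with the convention $u_{-1}:=0$ (when composing, values at negative indices are set to zero). $\nabla^\ell$ is the $\ell$-fold composition, so for $n\ge\ell$ one has $\nabla^\ell u_n=\sum_{k=0}^{\ell}(-1)^k\binom{\ell}{k}u_{n-k}$. The Pochhammer symbol is $(a)_\ell:=a(a+1)\cdots(a+\ell-1)$. *)

theory Defs
  imports "HOL-Analysis.Analysis"
begin

text \<open>The case \<open>n = 0\<close> implements the convention \<open>u\<^sub>-\<^sub>1 = 0\<close>; the \<open>l\<close>-fold
  composition is the functional power \<open>nabla ^^ l\<close>.\<close>

definition nabla :: "(nat \<Rightarrow> complex) \<Rightarrow> nat \<Rightarrow> complex" where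
  "nabla u n = (case n of 0 \<Rightarrow> u 0 | Suc m \<Rightarrow> u n - u m)"

definition admissible :: "nat \<Rightarrow> (nat \<Rightarrow> complex) set" where
  "admissible l = {u. finite {n. u n \<noteq> 0} \<and> (\<forall>n<l. u n = 0)}"

definition hardy_const :: "nat \<Rightarrow> real \<Rightarrow> real" where
  "hardy_const l p = (pochhammer ((p - 1) / p) l) powr p"

text \<open>Infinite sums are written with \<open>infsum\<close>, which is \<open>0\<close> for families that are not
  summable. The next lemma shows that \<open>nabla\<close> preserves finite support, so all the sums
  taken over admissible sequences have only finitely many nonzero terms.\<close>

lemma finite_support_nabla_funpow:
  assumes "finite {n. u n \<noteq> 0}"
  shows "finite {n. (nabla ^^ l) u n \<noteq> 0}"
proof (induction l)
  case 0
  then show ?case using assms by simp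
next
  case (Suc l)
  let ?v = "(nabla ^^ l) u"
  have "{n. nabla ?v n \<noteq> 0} \<subseteq> {n. ?v n \<noteq> 0} \<union> Suc ` {n. ?v n \<noteq> 0}"
  proof
    fix n assume "n \<in> {n. nabla ?v n \<noteq> 0}"
    then show "n \<in> {n. ?v n \<noteq> 0} \<union> Suc ` {n. ?v n \<noteq> 0}"
      by (cases n) (auto simp: nabla_def)
  qed
  moreover have "finite ({n. ?v n \<noteq> 0} \<union> Suc ` {n. ?v n \<noteq> 0})"
    using Suc by simp
  ultimately have "finite {n. nabla ?v n \<noteq> 0}"
    by (rule finite_subset)
  then show ?case by simp
qed

end

theory Submission
  imports Defs
begin

text \<open>
  Let \<open>w\<^sub>m = u\<^sub>m\<^sub>+\<^sub>l\<close>. The Cesaro-type quotients \<open>x\<^sub>m = (\<nabla>\<^sup>l\<^sup>-\<^sup>j w)\<^sub>m / binom(m + j, j)\<close> at levels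
  \<open>j\<close> and \<open>j - 1\<close> (the latter called \<open>y\<close>) satisfy \<open>y\<^sub>m = x\<^sub>m + (m/j) (x\<^sub>m - x\<^sub>m\<^sub>-\<^sub>1)\<close>. Taking moduli and multiplying by
  \<open>\<bar>x\<^sub>m\<bar>\<^sup>p\<^sup>-\<^sup>1\<close>, Young's inequality gives a telescoping sum and
  \<open>\<Sum> \<bar>y\<^sub>m\<bar>\<^sup>p \<ge> (1 - 1/(jp))\<^sup>p \<Sum> \<bar>x\<^sub>m\<bar>\<^sup>p\<close>. The product of these constants over \<open>j = 1, \<dots>, l\<close>, together with
  \<open>l! binom(m + l, l) \<le> (m + l)\<^sup>l\<close>, is the inequality.

  For optimality, replacing \<open>s\<close> by \<open>(1 - D\<^sub>N)\<^sup>l s\<close>, where \<open>D\<^sub>N\<close> averages the \<open>N\<close> preceding values, turns a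
  sequence with finitely supported \<open>\<nabla>\<^sup>l s\<close> into a finitely supported one and changes \<open>\<nabla>\<^sup>l s\<close> by
  something of size \<open>O(1/N)\<close> in the supremum norm and \<open>O(1)\<close> in the \<open>1\<close>-norm, hence small in the \<open>p\<close>-norm.
  So the inequality may be tested on \<open>\<nabla>\<^sup>l s = g\<close> cut off at \<open>M\<close> with \<open>g\<^sub>m = binom(m - 1/p, m)\<close>, for which
  \<open>s\<^sub>m = binom(m + l - 1/p, m)\<close> below \<open>M\<close>. Then \<open>s\<^sub>m / (g\<^sub>m (m + l)\<^sup>l)\<close> tends to the reciprocal of
  \<open>((p - 1)/p)\<^sub>l\<close>, while \<open>\<Sum> g\<^sub>m\<^sup>p\<close> diverges.
\<close>

subsection \<open>The inequality\<close>

lemma Young_powr: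
  fixes a b p :: real
  assumes "1 < p" "0 \<le> a" "0 \<le> b"
  shows "a * b powr (p - 1) \<le> a powr p / p + (1 - 1 / p) * b powr p"
proof -
  have "a * b powr (p - 1) \<le> a powr p / p + (b powr (p - 1)) powr (p / (p - 1)) / (p / (p - 1))"
    by (rule Youngs_inequality) (use assms in \<open>auto simp: field_simps\<close>)
  also have "(b powr (p - 1)) powr (p / (p - 1)) / (p / (p - 1)) = (1 - 1 / p) * b powr p"
  proof -
    have "(p - 1) * (p / (p - 1)) = p" using assms by simp
    then show ?thesis using assms by (simp add: powr_powr diff_divide_distrib algebra_simps)
  qed
  finally show ?thesis .
qed

text \<open>Young's inequality is applied with \<open>a\<close> scaled by \<open>1/\<kappa>\<close>,
  where \<open>\<kappa> = 1 - 1/(c p)\<close>. For this value the coefficient of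
  \<open>y powr p\<close> exceeds \<open>\<kappa>\<close> by exactly \<open>(m + 1)/c\<close>, so
  the bracket telescopes when \<open>x\<close> and \<open>y\<close> are consecutive terms.\<close>

lemma weighted_mean_step:
  fixes a c p x y :: real
  assumes "1 < p" "1 \<le> c" "0 \<le> a" "0 \<le> x" "0 \<le> y"
    and le: "(1 + real m / c) * y \<le> a + real m / c * x"
  shows "(1 - 1 / (c * p)) powr p * y powr p
      + (1 - 1 / (c * p)) powr (p - 1) / c * (real (Suc m) * y powr p - real m * x powr p)
    \<le> a powr p"
proof -
  define \<kappa> where "\<kappa> = 1 - 1 / (c * p)"
  have "1 < c * p"
    using assms by (smt (verit) mult_le_cancel_right1)
  then have \<kappa>: "0 < \<kappa>"
    by (simp add: \<kappa>_def)
  have "(1 + real m / c) * y powr p = (1 + real m / c) * y * y powr (p - 1)"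
    using powr_mult_base[of y "p - 1"] assms by simp
  also have "\<dots> \<le> (a + real m / c * x) * y powr (p - 1)"
    by (intro mult_right_mono le) simp
  also have "\<dots> = \<kappa> * ((a / \<kappa>) * y powr (p - 1)) + real m / c * (x * y powr (p - 1))"
    using \<kappa> by (simp add: algebra_simps)
  also have "\<dots> \<le> \<kappa> * ((a / \<kappa>) powr p / p + (1 - 1 / p) * y powr p)
      + real m / c * (x powr p / p + (1 - 1 / p) * y powr p)"
    using assms \<kappa> by (intro add_mono mult_left_mono Young_powr) auto
  finally have "(1 + real m / c) * y powr p \<le> \<dots>" .
  then have "p * ((1 + real m / c) * y powr p) \<le> p * (\<kappa> * ((a / \<kappa>) powr p / p + (1 - 1 / p) * y powr p)
      + real m / c * (x powr p / p + (1 - 1 / p) * y powr p))"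
    using assms by (intro mult_left_mono) auto
  also have "\<dots> = \<kappa> * (a / \<kappa>) powr p + \<kappa> * (p - 1) * y powr p
      + real m / c * x powr p + real m / c * (p - 1) * y powr p"
    using assms by (simp add: distrib_left right_diff_distrib left_diff_distrib)
  finally have "(p + real m / c - \<kappa> * (p - 1)) * y powr p \<le> \<kappa> * (a / \<kappa>) powr p + real m / c * x powr p"
    by (simp add: distrib_left right_diff_distrib left_diff_distrib distrib_right mult_ac diff_divide_distrib)
  moreover have "p + real m / c - \<kappa> * (p - 1) = \<kappa> + real (Suc m) / c"
    using assms by (simp add: \<kappa>_def field_simps)
  ultimately have "(\<kappa> + real (Suc m) / c) * y powr p \<le> \<kappa> * (a / \<kappa>) powr p + real m / c * x powr p"
    by metis
  then have "\<kappa> * y powr p + (real (Suc m) * y powr p - real m * x powr p) / c \<le> \<kappa> * (a / \<kappa>) powr p"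
    by (simp add: distrib_right diff_divide_distrib)
  \<comment> \<open>This factor removes the scaling: \<open>\<kappa> * (a / \<kappa>) powr p\<close>
    becomes \<open>a powr p\<close>.\<close>
  then have "\<kappa> powr (p - 1) * (\<kappa> * y powr p + (real (Suc m) * y powr p - real m * x powr p) / c)
     \<le> \<kappa> powr (p - 1) * (\<kappa> * (a / \<kappa>) powr p)"
    by (intro mult_left_mono) auto
  moreover have "\<kappa> powr (p - 1) * \<kappa> = \<kappa> powr p"
    using powr_mult_base[of \<kappa> "p - 1"] \<kappa> by (simp add: mult.commute)
  moreover have "\<kappa> powr p * (a / \<kappa>) powr p = a powr p"
    using \<kappa> by (simp flip: powr_mult)
  ultimately show ?thesis
    unfolding \<kappa>_def[symmetric] by (simp add: distrib_left mult.assoc[symmetric])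
qed

lemma weighted_mean_Hardy:
  fixes x y :: "nat \<Rightarrow> real"
  assumes "1 < p" "1 \<le> c" "\<And>m. 0 \<le> x m" "\<And>m. 0 \<le> y m"
    and step: "\<And>m. (1 + real m / c) * x m \<le> y m + real m / c * x (m - 1)"
  shows "(1 - 1 / (c * p)) powr p * (\<Sum>m<M. x m powr p) \<le> (\<Sum>m<M. y m powr p)"
proof -
  define \<kappa> where "\<kappa> = 1 - 1 / (c * p)"
  \<comment> \<open>The telescoped boundary term is kept for the induction and dropped afterwards.
    At \<open>M = 0\<close> the truncated index \<open>M - 1\<close> is harmless because of the
    factor \<open>real M\<close>.\<close>
  have "\<kappa> powr p * (\<Sum>m<M. x m powr p) + \<kappa> powr (p - 1) / c * (real M * x (M - 1) powr p)
      \<le> (\<Sum>m<M. y m powr p)"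
  proof (induction M)
    case (Suc M)
    have "\<kappa> powr p * x M powr p
        + \<kappa> powr (p - 1) / c * (real (Suc M) * x M powr p - real M * x (M - 1) powr p) \<le> y M powr p"
      unfolding \<kappa>_def by (rule weighted_mean_step) (use assms in auto)
    with Suc show ?case
      by (simp add: algebra_simps)
  qed simp
  moreover have "0 \<le> \<kappa> powr (p - 1) / c * (real M * x (M - 1) powr p)"
    using assms by simp
  ultimately show ?thesis
    unfolding \<kappa>_def by linarith
qed

section \<open>Binomial weights and Cesaro quotients\<close>

lemma binomial_shift_identities:
  fixes m j :: nat
  shows "real (Suc j) * real ((m + Suc j) choose Suc j) = (real m + real (Suc j)) * real ((m + j) choose j)"
    and "real (Suc j) * real ((m + j) choose Suc j) = real m * real ((m + j) choose j)"
proof -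
  have "Suc j * ((m + Suc j) choose Suc j) = (m + Suc j) * ((m + j) choose j)"
    using Suc_times_binomial_eq[of "m + j" j] by (simp add: mult.commute)
  then show 1: "real (Suc j) * real ((m + Suc j) choose Suc j) = (real m + real (Suc j)) * real ((m + j) choose j)"
    by (metis of_nat_add of_nat_mult)
  have "real ((m + Suc j) choose Suc j) = real ((m + j) choose j) + real ((m + j) choose Suc j)"
    by simp
  with 1 show "real (Suc j) * real ((m + j) choose Suc j) = real m * real ((m + j) choose j)"
    by (simp add: algebra_simps)
qed

text \<open>For \<open>m > 0\<close> this is the triangle inequality for
  \<open>s m = nabla s m + s (m - 1)\<close>, divided by \<open>binom(m + j, j)\<close>; the two
  identities above turn both neighbouring weights into multiples of this one.\<close>

lemma Cesaro_quotient_step: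
  fixes s :: "nat \<Rightarrow> complex" and j :: nat
  defines "x \<equiv> \<lambda>m. cmod (s m) / real ((m + Suc j) choose Suc j)"
  shows "(1 + real m / real (Suc j)) * x m
    \<le> cmod (nabla s m) / real ((m + j) choose j) + real m / real (Suc j) * x (m - 1)"
proof -
  define b where "b = real ((m + j) choose j)"
  have b: "b > 0" by (simp add: b_def)
  have x: "(1 + real m / real (Suc j)) * x m = cmod (s m) / b"
  proof -
    have "real ((m + Suc j) choose Suc j) = (1 + real m / real (Suc j)) * b"
      using binomial_shift_identities(1)[of j m] by (simp add: b_def field_simps)
    moreover have "1 + real m / real (Suc j) > 0"
      by (simp add: add_pos_nonneg)
    ultimately show ?thesis
      unfolding x_def by simp
  qed
  show ?thesis
  proof (cases m)
    case 0
    with x show ?thesis by (simp add: nabla_def b_def)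
  next
    case (Suc k)
    have "real ((k + Suc j) choose Suc j) = real m / real (Suc j) * b"
      using binomial_shift_identities(2)[of j m] Suc by (simp add: b_def field_simps)
    then have x': "real m / real (Suc j) * x (m - 1) = cmod (s k) / b"
      using Suc unfolding x_def by simp
    have "cmod (s m) \<le> cmod (nabla s m) + cmod (s k)"
      using norm_triangle_ineq[of "s m - s k" "s k"] Suc by (simp add: nabla_def)
    then have "cmod (s m) / b \<le> cmod (nabla s m) / b + cmod (s k) / b"
      using b by (simp add: divide_right_mono flip: add_divide_distrib)
    then show ?thesis
      unfolding x x' b_def .
  qed
qed

text \<open>Each level contributes its factor with \<open>c = Suc l\<close>; the induction peels off
  the innermost gradient, so its hypothesis is used for \<open>nabla s\<close>.\<close>

lemma nabla_funpow_Hardy: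
  fixes s :: "nat \<Rightarrow> complex"
  assumes "1 < p"
  shows "(\<Prod>j<l. 1 - 1 / (real (Suc j) * p)) powr p
      * (\<Sum>m<M. (cmod (s m) / real ((m + l) choose l)) powr p)
    \<le> (\<Sum>m<M. cmod ((nabla ^^ l) s m) powr p)"
proof (induction l arbitrary: s)
  case (Suc l)
  let ?P = "(\<Prod>j<l. 1 - 1 / (real (Suc j) * p)) powr p"
  have "(1 - 1 / (real (Suc l) * p)) powr p * (\<Sum>m<M. (cmod (s m) / real ((m + Suc l) choose Suc l)) powr p)
      \<le> (\<Sum>m<M. (cmod (nabla s m) / real ((m + l) choose l)) powr p)"
    by (rule weighted_mean_Hardy[OF assms]) (use Cesaro_quotient_step in auto)
  then have "?P * ((1 - 1 / (real (Suc l) * p)) powr p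
      * (\<Sum>m<M. (cmod (s m) / real ((m + Suc l) choose Suc l)) powr p))
      \<le> ?P * (\<Sum>m<M. (cmod (nabla s m) / real ((m + l) choose l)) powr p)"
    by (intro mult_left_mono) auto
  also have "\<dots> \<le> (\<Sum>m<M. cmod ((nabla ^^ Suc l) s m) powr p)"
    using Suc.IH[of "nabla s"] by (simp add: funpow_swap1)
  finally show ?case
    by (simp add: powr_mult mult.assoc)
qed simp

text \<open>Factoring \<open>j + 1\<close> out of \<open>(p - 1)/p + j\<close> leaves
  \<open>1 - 1/((j + 1) p)\<close>. The remaining \<open>l!\<close> is supplied by the binomial
  weights.\<close>

lemma pochhammer_eq_fact_prod:
  fixes p :: real
  assumes "0 < p"
  shows "pochhammer ((p - 1) / p) l = fact l * (\<Prod>j<l. 1 - 1 / (real (Suc j) * p))"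
proof (induction l)
  case (Suc l)
  have "(p - 1) / p + real l = real (Suc l) * (1 - 1 / (real (Suc l) * p))"
    using assms by (simp add: right_diff_distrib diff_divide_distrib)
  then show ?case
    by (simp only: pochhammer_Suc Suc prod.lessThan_Suc fact_Suc of_nat_mult mult_ac)
qed simp

lemma nabla_funpow_Hardy_shifted:
  fixes s :: "nat \<Rightarrow> complex"
  assumes "1 < p"
  shows "hardy_const l p * (\<Sum>m<M. cmod (s m) powr p / real (m + l) powr (real l * p))
    \<le> (\<Sum>m<M. cmod ((nabla ^^ l) s m) powr p)"
proof -
  have "fact l powr p * (cmod (s m) powr p / real (m + l) powr (real l * p))
      \<le> (cmod (s m) / real ((m + l) choose l)) powr p" for m
  proof (cases "m + l = 0")
    case False
    have "real (((m + l) choose l) * fact l) \<le> real ((m + l) ^ l)"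
      using binomial_fact_pow[of "m + l" l] by (simp only: of_nat_le_iff)
    moreover have "real (m + l) ^ l > 0" "real ((m + l) choose l) > 0"
      using False by auto
    ultimately have le: "fact l / real (m + l) ^ l \<le> 1 / real ((m + l) choose l)"
      by (simp add: divide_le_eq le_divide_eq mult.commute)
    have "fact l powr p * (cmod (s m) powr p / real (m + l) powr (real l * p))
       = (cmod (s m) * (fact l / real (m + l) ^ l)) powr p"
      using False by (simp add: powr_mult powr_divide powr_powr mult.commute flip: powr_realpow of_nat_add)
    also have "\<dots> \<le> (cmod (s m) * (1 / real ((m + l) choose l))) powr p"
      using le assms by (intro powr_mono2 mult_left_mono) auto
    finally show ?thesis by simp
  \<comment> \<open>For \<open>m = l = 0\<close> the left side is \<open>0\<close>, since
    \<open>0 powr 0 = 0\<close> and division by zero gives \<open>0\<close>.\<close>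
  qed (use assms in auto)
  then have "fact l powr p * (\<Sum>m<M. cmod (s m) powr p / real (m + l) powr (real l * p))
    \<le> (\<Sum>m<M. (cmod (s m) / real ((m + l) choose l)) powr p)"
    unfolding sum_distrib_left by (intro sum_mono) blast
  then have "(\<Prod>j<l. 1 - 1 / (real (Suc j) * p)) powr p
        * (fact l powr p * (\<Sum>m<M. cmod (s m) powr p / real (m + l) powr (real l * p)))
      \<le> (\<Sum>m<M. cmod ((nabla ^^ l) s m) powr p)"
    by (intro order.trans[OF mult_left_mono nabla_funpow_Hardy[OF assms]]) auto
  then show ?thesis
    using assms by (simp add: hardy_const_def pochhammer_eq_fact_prod powr_mult mult_ac)
qed

subsection \<open>Extension to sequences with finitely supported differences\<close>

text \<open>Convolution with the uniform weights on \<open>1..N\<close>; negative indices count as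
  zero, in accordance with \<open>nabla\<close>.\<close>

definition delayed_mean :: "nat \<Rightarrow> (nat \<Rightarrow> complex) \<Rightarrow> nat \<Rightarrow> complex" where
  "delayed_mean N t n = (\<Sum>i = 1..N. if i \<le> n then t (n - i) else 0) / of_nat N"

definition dilute :: "nat \<Rightarrow> (nat \<Rightarrow> complex) \<Rightarrow> nat \<Rightarrow> complex" where
  "dilute N t n = t n - delayed_mean N t n"

text \<open>Both operators are convolutions of sequences extended by zero, hence they commute; the
  index \<open>i = Suc m\<close> contributes \<open>nabla t 0 = t 0\<close>.\<close>

lemma nabla_delayed_mean: "nabla (delayed_mean N t) = delayed_mean N (nabla t)"
proof
  fix n
  show "nabla (delayed_mean N t) n = delayed_mean N (nabla t) n"
  proof (cases n)
    case (Suc m)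
    have "(if i \<le> Suc m then t (Suc m - i) else 0) - (if i \<le> m then t (m - i) else 0)
        = (if i \<le> Suc m then nabla t (Suc m - i) else 0)" for i
      by (cases "i \<le> m") (auto simp: nabla_def Suc_diff_le not_le le_Suc_eq)
    then show ?thesis
      using Suc by (simp add: nabla_def[of "delayed_mean N t"] delayed_mean_def
          flip: sum_subtractf diff_divide_distrib)
  qed (simp add: nabla_def delayed_mean_def)
qed

lemma nabla_dilute: "nabla (dilute N t) = dilute N (nabla t)"
proof
  fix n
  have "nabla (dilute N t) n = nabla t n - nabla (delayed_mean N t) n"
    by (simp add: nabla_def dilute_def split: nat.split)
  then show "nabla (dilute N t) n = dilute N (nabla t) n"
    by (simp add: nabla_delayed_mean dilute_def)
qed

lemma nabla_funpow_dilute: "(nabla ^^ k) (dilute N t) = dilute N ((nabla ^^ k) t)"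
  by (induction k) (simp_all add: nabla_dilute)

lemma nabla_funpow_dilute_funpow:
  "(nabla ^^ k) ((dilute N ^^ j) t) = (dilute N ^^ j) ((nabla ^^ k) t)"
  by (induction j) (simp_all add: nabla_funpow_dilute)

text \<open>A sequence with finitely supported gradient is eventually constant, hence
  eventually equal to its delayed mean.\<close>

lemma finite_support_dilute:
  assumes "finite {n. nabla t n \<noteq> 0}" "0 < N"
  shows "finite {n. dilute N t n \<noteq> 0}"
proof -
  obtain M where M: "\<And>n. nabla t n \<noteq> 0 \<Longrightarrow> n < M"
    using assms(1) finite_nat_set_iff_bounded by auto
  have const: "t (M + n) = t M" for n
  proof (induction n)
    case (Suc n)
    have "nabla t (Suc (M + n)) = 0"
      using M[of "Suc (M + n)"] by auto
    with Suc show ?case by (simp add: nabla_def)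
  qed simp
  have "dilute N t n = 0" if "M + N \<le> n" for n
  proof -
    have eq: "t k = t M" if "M \<le> k" for k
      using const[of "k - M"] that by simp
    have "(\<Sum>i = 1..N. if i \<le> n then t (n - i) else 0) = (\<Sum>i = 1..N. t M)"
      by (rule sum.cong) (use \<open>M + N \<le> n\<close> in \<open>auto intro: eq\<close>)
    then show ?thesis
      using assms(2) eq[of n] that by (simp add: dilute_def delayed_mean_def)
  qed
  then have "{n. dilute N t n \<noteq> 0} \<subseteq> {..<M + N}"
    by (auto simp: not_le[symmetric])
  then show ?thesis
    using finite_subset by blast
qed

text \<open>Dilution commutes with \<open>nabla\<close>, so each application lowers by one the order
  of the gradient known to have finite support.\<close>

lemma finite_support_dilute_funpow:
  assumes "finite {n. (nabla ^^ k) t n \<noteq> 0}" "0 < N"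
  shows "finite {n. (dilute N ^^ k) t n \<noteq> 0}"
  using assms(1)
proof (induction k arbitrary: t)
  case (Suc k)
  have "finite {n. nabla ((nabla ^^ k) t) n \<noteq> 0}"
    using Suc.prems by simp
  then have "finite {n. (nabla ^^ k) (dilute N t) n \<noteq> 0}"
    unfolding nabla_funpow_dilute using assms(2) by (rule finite_support_dilute)
  then have "finite {n. (dilute N ^^ k) (dilute N t) n \<noteq> 0}"
    by (rule Suc.IH)
  then show ?case by (simp add: funpow_swap1)
qed simp

section \<open>Norm bounds for delayed means and dilutions\<close>

lemma sum_shift_le:
  fixes f :: "nat \<Rightarrow> real"
  assumes "\<And>n. 0 \<le> f n"
  shows "(\<Sum>n<R. if i \<le> n then f (n - i) else 0) \<le> (\<Sum>n<R. f n)"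
proof -
  have "(\<Sum>n<R. if i \<le> n then f (n - i) else 0) = (\<Sum>n\<in>{i..<R}. f (n - i))"
    by (rule sum.mono_neutral_cong_right) auto
  also have "\<dots> = (\<Sum>n\<in>(\<lambda>n. n - i) ` {i..<R}. f n)"
    by (subst sum.reindex) (auto simp: inj_on_def)
  also have "\<dots> \<le> (\<Sum>n<R. f n)"
    by (rule sum_mono2) (use assms in auto)
  finally show ?thesis .
qed

lemma sum_norm_delayed_mean_le:
  "(\<Sum>n<R. cmod (delayed_mean N t n)) \<le> (\<Sum>n<R. cmod (t n))"
proof (cases "N = 0")
  case False
  have "cmod (delayed_mean N t n) \<le> (\<Sum>i = 1..N. if i \<le> n then cmod (t (n - i)) else 0) / N" for n
    unfolding delayed_mean_def norm_divide norm_of_nat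
    by (intro divide_right_mono order.trans[OF norm_sum] sum_mono) auto
  then have "(\<Sum>n<R. cmod (delayed_mean N t n))
      \<le> (\<Sum>n<R. (\<Sum>i = 1..N. if i \<le> n then cmod (t (n - i)) else 0) / N)"
    by (rule sum_mono)
  also have "\<dots> = (\<Sum>i = 1..N. (\<Sum>n<R. if i \<le> n then cmod (t (n - i)) else 0)) / N"
    by (subst sum.swap) (simp flip: sum_divide_distrib)
  also have "\<dots> \<le> (\<Sum>i = 1..N. (\<Sum>n<R. cmod (t n))) / N"
    by (intro divide_right_mono sum_mono sum_shift_le) auto
  finally show ?thesis
    using False by simp
qed (simp add: delayed_mean_def sum_nonneg)

text \<open>The window meets distinct indices below \<open>n\<close>, so its sum stays below the
  whole partial sum; the surviving factor \<open>1/N\<close> gives smallness in the supremum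
  norm.\<close>

lemma norm_delayed_mean_le:
  "cmod (delayed_mean N t n) \<le> (\<Sum>k<n. cmod (t k)) / N"
proof -
  have "cmod (\<Sum>i = 1..N. if i \<le> n then t (n - i) else 0)
      \<le> (\<Sum>i = 1..N. if i \<le> n then cmod (t (n - i)) else 0)"
    by (intro order.trans[OF norm_sum] sum_mono) auto
  also have "\<dots> = (\<Sum>i\<in>{1..min N n}. cmod (t (n - i)))"
    by (rule sum.mono_neutral_cong_right) auto
  also have "\<dots> = (\<Sum>k\<in>(\<lambda>i. n - i) ` {1..min N n}. cmod (t k))"
    by (subst sum.reindex) (auto simp: inj_on_def)
  also have "\<dots> \<le> (\<Sum>k<n. cmod (t k))"
    by (rule sum_mono2) auto
  finally show ?thesis
    by (simp add: delayed_mean_def norm_divide divide_right_mono)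
qed

lemma sum_norm_dilute_funpow_le:
  "(\<Sum>n<R. cmod ((dilute N ^^ k) t n)) \<le> 2 ^ k * (\<Sum>n<R. cmod (t n))"
proof (induction k)
  case (Suc k)
  let ?s = "(dilute N ^^ k) t"
  have "(\<Sum>n<R. cmod (dilute N ?s n)) \<le> (\<Sum>n<R. cmod (?s n) + cmod (delayed_mean N ?s n))"
    unfolding dilute_def by (intro sum_mono norm_triangle_ineq4)
  also have "\<dots> \<le> 2 * (\<Sum>n<R. cmod (?s n))"
    using sum_norm_delayed_mean_le[where t = ?s and R = R and N = N] by (simp add: sum.distrib)
  finally show ?case
    using Suc by simp
qed simp

text \<open>Averaging the \<open>k\<close>-fold dilution once more costs a factor
  \<open>2 ^ k\<close>, and these costs add up geometrically.\<close>

lemma norm_dilute_funpow_diff_le: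
  "cmod ((dilute N ^^ k) t n - t n) \<le> 2 ^ k * (\<Sum>i<n. cmod (t i)) / N"
proof (induction k)
  case (Suc k)
  let ?s = "(dilute N ^^ k) t"
  have "cmod (dilute N ?s n - t n) \<le> cmod (?s n - t n) + cmod (delayed_mean N ?s n)"
    using norm_triangle_ineq4[of "?s n - t n" "delayed_mean N ?s n"]
    by (simp add: dilute_def algebra_simps)
  moreover have "cmod (delayed_mean N ?s n) \<le> 2 ^ k * (\<Sum>i<n. cmod (t i)) / N"
    by (intro order.trans[OF norm_delayed_mean_le] divide_right_mono sum_norm_dilute_funpow_le) simp
  ultimately show ?case
    using Suc by simp
qed (simp add: sum_nonneg)

lemma dilute_funpow_tendsto: "(\<lambda>N. (dilute N ^^ k) t n) \<longlonglongrightarrow> t n"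
proof -
  have "(\<lambda>N. 2 ^ k * (\<Sum>i<n. cmod (t i)) / real N) \<longlonglongrightarrow> 0"
    by (intro lim_const_over_n)
  then have "(\<lambda>N. (dilute N ^^ k) t n - t n) \<longlonglongrightarrow> 0"
    by (rule Lim_null_comparison[rotated]) (simp add: norm_dilute_funpow_diff_le)
  then show ?thesis
    using LIM_zero_iff by blast
qed

text \<open>Beyond \<open>M\<close> the dilution of \<open>v\<close> is pure error. Its
  \<open>p\<close>-th powers are bounded by interpolating between the supremum bound
  \<open>O(1/N)\<close> and the bounded 1-norm, uniformly in \<open>R\<close>.\<close>

lemma sum_dilute_funpow_powr_le:
  fixes p :: real
  assumes "1 < p" and v: "\<And>n. M \<le> n \<Longrightarrow> v n = 0"
  defines "S \<equiv> \<Sum>n<M. cmod (v n)"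
  shows "(\<Sum>n<R. cmod ((dilute N ^^ k) v n) powr p)
    \<le> (\<Sum>n<M. cmod ((dilute N ^^ k) v n) powr p) + (2 ^ k * S / N) powr (p - 1) * (2 ^ k * S)"
proof -
  let ?w = "(dilute N ^^ k) v"
  have S: "(\<Sum>n<r. cmod (v n)) \<le> S" for r
  proof -
    have "(\<Sum>n<r. cmod (v n)) = (\<Sum>n\<in>{..<r} \<inter> {..<M}. cmod (v n))"
      by (rule sum.mono_neutral_right) (simp_all add: Diff_Int v)
    also have "\<dots> \<le> S"
      unfolding S_def by (rule sum_mono2) auto
    finally show ?thesis .
  qed
  have tail: "cmod (?w n) powr p \<le> (2 ^ k * S / N) powr (p - 1) * cmod (?w n)" if "M \<le> n" for n
  proof -
    have "cmod (?w n) \<le> 2 ^ k * (\<Sum>i<n. cmod (v i)) / N"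
      using norm_dilute_funpow_diff_le[of k N v n] v[OF that] by simp
    also have "\<dots> \<le> 2 ^ k * S / N"
      by (intro divide_right_mono mult_left_mono S) auto
    finally have "cmod (?w n) powr (p - 1) \<le> (2 ^ k * S / N) powr (p - 1)"
      using assms(1) by (intro powr_mono2) auto
    then have "cmod (?w n) * cmod (?w n) powr (p - 1) \<le> cmod (?w n) * (2 ^ k * S / N) powr (p - 1)"
      by (intro mult_left_mono) auto
    then show ?thesis
      by (simp add: powr_mult_base mult.commute)
  qed
  have "(\<Sum>n<R. cmod (?w n) powr p) \<le> (\<Sum>n\<in>{..<M} \<union> {M..<R}. cmod (?w n) powr p)"
    by (rule sum_mono2) auto
  also have "\<dots> = (\<Sum>n<M. cmod (?w n) powr p) + (\<Sum>n\<in>{M..<R}. cmod (?w n) powr p)"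
    by (rule sum.union_disjoint) auto
  also have "(\<Sum>n\<in>{M..<R}. cmod (?w n) powr p)
      \<le> (2 ^ k * S / N) powr (p - 1) * (\<Sum>n\<in>{M..<R}. cmod (?w n))"
    unfolding sum_distrib_left by (intro sum_mono tail) auto
  also have "\<dots> \<le> (2 ^ k * S / N) powr (p - 1) * (2 ^ k * S)"
  proof (rule mult_left_mono)
    have "(\<Sum>n\<in>{M..<R}. cmod (?w n)) \<le> (\<Sum>n<R. cmod (?w n))"
      by (rule sum_mono2) auto
    also have "\<dots> \<le> 2 ^ k * S"
      by (intro order.trans[OF sum_norm_dilute_funpow_le] mult_left_mono S) auto
    finally show "(\<Sum>n\<in>{M..<R}. cmod (?w n)) \<le> 2 ^ k * S" .
  qed auto
  finally show ?thesis by simp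
qed

text \<open>The hypothesis is applied to the \<open>l\<close>-fold dilution of \<open>s\<close>, and
  \<open>N\<close> tends to infinity. The \<open>R\<close> it yields may depend on \<open>N\<close>,
  hence the tail bound uniform in \<open>R\<close>; the remaining sums run below \<open>M\<close>,
  so pointwise convergence suffices.\<close>

lemma Hardy_extension:
  fixes B p :: real and l :: nat
  assumes "1 < p" "0 \<le> B"
    and ineq: "\<And>t. finite {n. t n \<noteq> 0} \<Longrightarrow>
      \<exists>R. \<forall>M. B * (\<Sum>m<M. cmod (t m) powr p / real (m + l) powr (real l * p))
         \<le> (\<Sum>m<R. cmod ((nabla ^^ l) t m) powr p)"
    and s: "\<And>n. M \<le> n \<Longrightarrow> (nabla ^^ l) s n = 0"
  shows "B * (\<Sum>m<M. cmod (s m) powr p / real (m + l) powr (real l * p))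
    \<le> (\<Sum>m<M. cmod ((nabla ^^ l) s m) powr p)"
proof -
  define v where "v = (nabla ^^ l) s"
  define S where "S = (\<Sum>n<M. cmod (v n))"
  have "{n. (nabla ^^ l) s n \<noteq> 0} \<subseteq> {..<M}"
    using s linorder_not_less by blast
  then have fin: "finite {n. (nabla ^^ l) s n \<noteq> 0}"
    by (rule finite_subset) simp
  have le: "B * (\<Sum>m<M. cmod ((dilute N ^^ l) s m) powr p / real (m + l) powr (real l * p))
      \<le> (\<Sum>m<M. cmod ((dilute N ^^ l) v m) powr p) + (2 ^ l * S / N) powr (p - 1) * (2 ^ l * S)"
    if N: "0 < N" for N
  proof -
    obtain R where "B * (\<Sum>m<M. cmod ((dilute N ^^ l) s m) powr p / real (m + l) powr (real l * p))
         \<le> (\<Sum>m<R. cmod ((nabla ^^ l) ((dilute N ^^ l) s) m) powr p)"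
      using ineq[OF finite_support_dilute_funpow[OF fin N]] by blast
    also have "\<dots> \<le> (\<Sum>m<M. cmod ((dilute N ^^ l) v m) powr p)
        + (2 ^ l * S / N) powr (p - 1) * (2 ^ l * S)"
      unfolding nabla_funpow_dilute_funpow S_def v_def
      by (rule sum_dilute_funpow_powr_le[OF assms(1) s])
    finally show ?thesis .
  qed
  have lim1: "(\<lambda>N. B * (\<Sum>m<M. cmod ((dilute N ^^ l) s m) powr p / real (m + l) powr (real l * p)))
      \<longlonglongrightarrow> B * (\<Sum>m<M. cmod (s m) powr p / real (m + l) powr (real l * p))"
    unfolding divide_inverse
    using assms(1) by (intro tendsto_mult tendsto_const tendsto_sum tendsto_powr' tendsto_norm dilute_funpow_tendsto) auto
  have "(\<lambda>N. (\<Sum>m<M. cmod ((dilute N ^^ l) v m) powr p) + (2 ^ l * S / real N) powr (p - 1) * (2 ^ l * S))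
      \<longlonglongrightarrow> (\<Sum>m<M. cmod (v m) powr p) + 0 powr (p - 1) * (2 ^ l * S)"
    using assms(1)
    by (intro tendsto_add tendsto_mult tendsto_const tendsto_sum tendsto_powr' tendsto_norm
        dilute_funpow_tendsto lim_const_over_n) (auto simp: S_def intro!: always_eventually divide_nonneg_nonneg mult_nonneg_nonneg sum_nonneg)
  then have lim2: "(\<lambda>N. (\<Sum>m<M. cmod ((dilute N ^^ l) v m) powr p) + (2 ^ l * S / real N) powr (p - 1) * (2 ^ l * S))
      \<longlonglongrightarrow> (\<Sum>m<M. cmod (v m) powr p)"
    by simp
  show ?thesis
    unfolding v_def[symmetric]
    by (rule tendsto_le[OF _ lim2 lim1])
       (use le in \<open>auto intro: eventually_mono[OF eventually_gt_at_top[of 0]]\<close>)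
qed

subsection \<open>Optimality of the constant\<close>

definition cumsum :: "(nat \<Rightarrow> complex) \<Rightarrow> nat \<Rightarrow> complex" where
  "cumsum t n = (\<Sum>k\<le>n. t k)"

lemma nabla_cumsum: "nabla (cumsum t) = t"
  by (rule ext) (simp add: nabla_def cumsum_def split: nat.split)

lemma nabla_funpow_cumsum_funpow: "(nabla ^^ k) ((cumsum ^^ k) t) = t"
proof (induction k)
  case (Suc k)
  have "(nabla ^^ Suc k) ((cumsum ^^ Suc k) t) = (nabla ^^ k) (nabla (cumsum ((cumsum ^^ k) t)))"
    by (simp add: funpow_swap1)
  with Suc show ?case
    by (simp only: nabla_cumsum)
qed simp

text \<open>Partial sums at \<open>n\<close> see only indices up to \<open>n\<close>, so cutting the
  test sequence off at \<open>M\<close> leaves its iterated sums unchanged below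
  \<open>M\<close>.\<close>

lemma cumsum_funpow_cong:
  assumes "\<And>n. n < M \<Longrightarrow> t n = t' n"
  shows "n < M \<Longrightarrow> (cumsum ^^ k) t n = (cumsum ^^ k) t' n"
  using assms by (induction k arbitrary: n) (auto simp: cumsum_def intro!: sum.cong)

text \<open>The numbers \<open>(a + n) gchoose n\<close> are the coefficients of
  \<open>(1 - z)^(-a-1)\<close>, and each summation multiplies by \<open>1/(1 - z)\<close>.\<close>

lemma cumsum_funpow_gbinomial:
  "(cumsum ^^ k) (\<lambda>n. of_real ((a + real n) gchoose n))
    = (\<lambda>n. of_real ((a + real k + real n) gchoose n))"
proof (induction k)
  case (Suc k)
  show ?case
  proof
    fix n
    have "(cumsum ^^ Suc k) (\<lambda>n. of_real ((a + real n) gchoose n)) n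
        = (\<Sum>i\<le>n. of_real ((a + real k + real i) gchoose i))"
      by (simp only: funpow.simps comp_apply Suc) (simp add: cumsum_def)
    also have "\<dots> = of_real ((a + real k + real n + 1) gchoose n)"
      by (simp only: gbinomial_parallel_sum flip: of_real_sum)
    finally show "(cumsum ^^ Suc k) (\<lambda>n. of_real ((a + real n) gchoose n)) n
        = of_real ((a + real (Suc k) + real n) gchoose n)"
      by (simp add: add_ac)
  qed
qed simp

text \<open>Both binomials are Pochhammer symbols over \<open>n!\<close>; the identity splits
  \<open>pochhammer (a + 1) (n + k)\<close> in two ways.\<close>

lemma gbinomial_shift_ratio:
  fixes a :: real
  assumes "-1 < a"
  shows "(a + real k + real n) gchoose n
    = ((a + real n) gchoose n) * pochhammer (a + 1 + real n) k / pochhammer (a + 1) k"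
proof -
  have "pochhammer (a + 1) k > 0"
    using assms by (intro pochhammer_pos) auto
  moreover have "pochhammer (a + 1) k * pochhammer (a + 1 + real k) n
      = pochhammer (a + 1) n * pochhammer (a + 1 + real n) k"
    by (metis add.commute pochhammer_product')
  ultimately show ?thesis
    by (simp add: gbinomial_pochhammer' field_simps)
qed

text \<open>Inductively it suffices to bound the ratio \<open>1 - 1/(p (n + 2))\<close> of
  consecutive coefficients below by \<open>((n + 1)/(n + 2)) powr (1/p)\<close>. The case
  \<open>n = 0\<close> is an equality.\<close>

lemma gbinomial_powr_harmonic_bound:
  fixes p :: real
  assumes "1 < p"
  shows "(1 - 1 / p) powr p / real (Suc n) \<le> ((- (1 / p) + real (Suc n)) gchoose (Suc n)) powr p"
proof (induction n)
  case (Suc n)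
  let ?g = "\<lambda>n. (- (1 / p) + real n) gchoose n"
  define x where "x = real (Suc n) / real (Suc (Suc n))"
  have x: "0 < x" by (simp add: x_def)
  have step: "?g (Suc (Suc n)) = ?g (Suc n) * (1 - 1 / p / real (Suc (Suc n)))"
  proof -
    have "1 - 1 / p + real (Suc n) = real (Suc (Suc n)) * (1 - 1 / p / real (Suc (Suc n)))"
      by (simp add: right_diff_distrib)
    moreover have "?g m = pochhammer (1 - 1 / p) m / fact m" for m
      by (simp add: gbinomial_pochhammer')
    ultimately show ?thesis
      by (simp only: pochhammer_Suc[of _ "Suc n"] fact_Suc[of "Suc n"] of_nat_mult) simp
  qed
  \<comment> \<open>Weighted AM-GM for \<open>x\<close> and \<open>1\<close>, that is, Bernoulli's
    inequality.\<close>
  have "x powr (1 / p) * 1 powr (1 - 1 / p) \<le> 1 / p * x + (1 - 1 / p) * 1"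
    by (rule Youngs_inequality_0) (use assms x in auto)
  also have "\<dots> = 1 - 1 / p / real (Suc (Suc n))"
  proof -
    have "x = 1 - 1 / real (Suc (Suc n))"
      by (simp add: x_def field_simps)
    then have "1 / p * x + (1 - 1 / p) * 1 = 1 / p * (1 - 1 / real (Suc (Suc n))) + (1 - 1 / p)"
      by (simp only: mult_1_right)
    also have "\<dots> = 1 - 1 / p / real (Suc (Suc n))"
      by (simp only: right_diff_distrib) simp
    finally show ?thesis .
  qed
  finally have "(x powr (1 / p)) powr p \<le> (1 - 1 / p / real (Suc (Suc n))) powr p"
    using assms x by (intro powr_mono2) auto
  then have "x \<le> (1 - 1 / p / real (Suc (Suc n))) powr p"
    using assms x by (simp add: powr_powr)
  with Suc have "(1 - 1 / p) powr p / real (Suc n) * x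
      \<le> ?g (Suc n) powr p * (1 - 1 / p / real (Suc (Suc n))) powr p"
    using x by (intro mult_mono) auto
  then show ?case
    unfolding step powr_mult by (simp add: x_def)
qed (simp add: gbinomial_pochhammer')

lemma gbinomial_powr_not_summable:
  fixes p :: real
  assumes "1 < p"
  shows "\<not> summable (\<lambda>n. ((- (1 / p) + real n) gchoose n) powr p)"
proof
  assume "summable (\<lambda>n. ((- (1 / p) + real n) gchoose n) powr p)"
  then have "summable (\<lambda>n. ((- (1 / p) + real (Suc n)) gchoose (Suc n)) powr p)"
    by (subst summable_Suc_iff)
  then have "summable (\<lambda>n. (1 - 1 / p) powr p / real (Suc n))"
    by (rule summable_comparison_test'[where N = 0])
      (use gbinomial_powr_harmonic_bound[OF assms] in auto)
  then have "summable (\<lambda>n. (1 - 1 / p) powr p * inverse (real n))"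
    by (subst (asm) summable_Suc_iff[where f = "\<lambda>n. (1 - 1 / p) powr p / real n"])
      (simp add: divide_inverse)
  then show False
    using assms not_summable_harmonic[where 'a = real] by (subst (asm) summable_cmult_iff) auto
qed

lemma power_le_pochhammer:
  fixes a :: real
  assumes "0 < a"
  shows "a ^ k \<le> pochhammer a k"
proof (induction k)
  case (Suc k)
  then show ?case
    unfolding pochhammer_Suc power_Suc2 using assms by (intro mult_mono less_imp_le[OF pochhammer_pos]) auto
qed simp

text \<open>If \<open>L > 1\<close>, the factors \<open>r n\<close> eventually exceed some
  \<open>1 + d\<close> with \<open>d > 0\<close>. The surplus \<open>d\<close> times any tail sum of
  \<open>g\<close> is then bounded by a fixed initial part, which would make \<open>g\<close>
  summable.\<close>

lemma not_summable_weighted_bound: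
  fixes g r :: "nat \<Rightarrow> real"
  assumes nn: "\<And>n. 0 \<le> g n" and ns: "\<not> summable g" and lim: "r \<longlonglongrightarrow> L"
    and le: "\<And>M. (\<Sum>n<M. g n * r n) \<le> (\<Sum>n<M. g n)"
  shows "L \<le> 1"
proof (rule ccontr)
  assume "\<not> L \<le> 1"
  define d where "d = (L - 1) / 2"
  have d: "0 < d" "1 + d < L"
    using \<open>\<not> L \<le> 1\<close> by (auto simp: d_def field_simps)
  have "eventually (\<lambda>n. 1 + d < r n) sequentially"
    by (rule order_tendstoD(1)[OF lim d(2)])
  then obtain n0 where n0: "\<And>n. n0 \<le> n \<Longrightarrow> 1 + d < r n"
    by (auto simp: eventually_sequentially)
  have "summable (\<lambda>n. g (n + n0))"
  proof (rule summableI_nonneg_bounded)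
    show "0 \<le> g (n + n0)" for n by (rule nn)
    fix M
    have split: "(\<Sum>n<M + n0. f n) = (\<Sum>n<n0. f n) + (\<Sum>n<M. f (n + n0))" for f :: "nat \<Rightarrow> real"
      by (induction M) (auto simp: add_ac)
    have "(\<Sum>n<M. g (n + n0)) * (1 + d) \<le> (\<Sum>n<M. g (n + n0) * r (n + n0))"
      unfolding sum_distrib_right by (intro sum_mono mult_left_mono nn less_imp_le[OF n0]) auto
    with le[of "M + n0"] have "(\<Sum>n<M. g (n + n0)) * d \<le> (\<Sum>n<n0. g n) - (\<Sum>n<n0. g n * r n)"
      unfolding split by (simp add: algebra_simps)
    then show "(\<Sum>n<M. g (n + n0)) \<le> ((\<Sum>n<n0. g n) - (\<Sum>n<n0. g n * r n)) / d"
      using d by (simp add: pos_le_divide_eq)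
  qed
  then show False
    using ns by simp
qed

lemma Hardy_constant_optimal:
  fixes B p :: real and l :: nat
  assumes "1 < p" "0 < l" "0 \<le> B"
    and ineq: "\<And>M s. (\<And>n. M \<le> n \<Longrightarrow> (nabla ^^ l) s n = 0) \<Longrightarrow>
      B * (\<Sum>m<M. cmod (s m) powr p / real (m + l) powr (real l * p))
      \<le> (\<Sum>m<M. cmod ((nabla ^^ l) s m) powr p)"
  shows "B \<le> hardy_const l p"
proof -
  \<comment> \<open>The critical exponent: \<open>g n\<close> decays like
    \<open>n powr (- 1/p)\<close>, so the sum of \<open>g n powr p\<close> only just
    diverges.\<close>
  define a where "a = - (1 / p)"
  define g where "g = (\<lambda>n. (a + real n) gchoose n)"
  define P where "P = pochhammer (a + 1) l"
  \<comment> \<open>A lower bound for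
    \<open>pochhammer (a + 1 + real n) l / real (n + l) ^ l\<close> that still tends to
    \<open>1\<close>.\<close>
  define q where "q = (\<lambda>n. ((a + 1 + real n) / real (n + l)) ^ l)"
  have a: "-1 < a" using assms by (simp add: a_def)
  then have P: "P > 0" unfolding P_def by (intro pochhammer_pos) auto
  have g: "0 < g n" for n
    unfolding g_def using a by (auto simp: gbinomial_pochhammer' intro!: divide_pos_pos pochhammer_pos)
  have "(\<Sum>n<M. g n powr p * (B * (q n / P) powr p)) \<le> (\<Sum>n<M. g n powr p)" for M
  proof -
    define v :: "nat \<Rightarrow> complex" where "v = (\<lambda>n. if n < M then of_real (g n) else 0)"
    define s where "s = (cumsum ^^ l) v"
    have v: "(nabla ^^ l) s = v"
      by (simp add: s_def nabla_funpow_cumsum_funpow)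
    have s: "s n = of_real (g n * pochhammer (a + 1 + real n) l / P)" if "n < M" for n
    proof -
      have "s n = (cumsum ^^ l) (\<lambda>n. of_real (g n)) n"
        unfolding s_def using that by (intro cumsum_funpow_cong[where M = M]) (auto simp: v_def)
      then show ?thesis
        unfolding g_def P_def cumsum_funpow_gbinomial using gbinomial_shift_ratio[OF a] by simp
    qed
    have "g n powr p * (B * (q n / P) powr p)
        \<le> B * (cmod (s n) powr p / real (n + l) powr (real l * p))" if "n < M" for n
    proof -
      have "n + l \<noteq> 0" using assms(2) by simp
      have "g n * (q n / P) = g n * (a + 1 + real n) ^ l / P / real (n + l) ^ l"
        by (simp add: q_def power_divide)
      also have "\<dots> \<le> g n * pochhammer (a + 1 + real n) l / P / real (n + l) ^ l"
        using a P g[of n] by (intro divide_right_mono mult_left_mono power_le_pochhammer) auto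
      also have "\<dots> = cmod (s n) / real (n + l) ^ l"
        unfolding s[OF that] norm_of_real
        using a P g[of n] pochhammer_nonneg[of "a + 1 + real n" l] by simp
      finally have "(g n * (q n / P)) powr p \<le> (cmod (s n) / real (n + l) ^ l) powr p"
        using assms(1) a P g[of n] by (intro powr_mono2) (auto simp: q_def)
      also have "\<dots> = cmod (s n) powr p / real (n + l) powr (real l * p)"
        using \<open>n + l \<noteq> 0\<close> by (simp add: powr_divide powr_powr flip: powr_realpow of_nat_add)
      finally have "B * (g n * (q n / P)) powr p \<le> B * \<dots>"
        using assms(3) by (rule mult_left_mono)
      then show ?thesis
        by (simp only: powr_mult mult_ac)
    qed
    then have "(\<Sum>n<M. g n powr p * (B * (q n / P) powr p))
        \<le> B * (\<Sum>m<M. cmod (s m) powr p / real (m + l) powr (real l * p))"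
      unfolding sum_distrib_left by (intro sum_mono) auto
    also have "\<dots> \<le> (\<Sum>m<M. cmod ((nabla ^^ l) s m) powr p)"
      by (rule ineq) (simp add: v, simp add: v_def)
    also have "\<dots> = (\<Sum>n<M. g n powr p)"
      by (rule sum.cong) (use less_imp_le[OF g] in \<open>auto simp: v v_def\<close>)
    finally show ?thesis .
  qed
  moreover have "(\<lambda>n. B * (q n / P) powr p) \<longlonglongrightarrow> B * (1 ^ l / P) powr p"
  proof -
    have "(\<lambda>n. 1 + (a + 1 - real l) / real (n + l)) \<longlonglongrightarrow> 1 + 0"
      by (intro tendsto_add tendsto_const LIMSEQ_ignore_initial_segment[OF lim_const_over_n])
    moreover have "eventually (\<lambda>n. 1 + (a + 1 - real l) / real (n + l) = (a + 1 + real n) / real (n + l)) sequentially"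
      by (rule eventually_mono[OF eventually_gt_at_top[of 0]]) (simp add: field_simps)
    ultimately have "(\<lambda>n. (a + 1 + real n) / real (n + l)) \<longlonglongrightarrow> 1"
      by (simp add: filterlim_cong)
    then show ?thesis
      unfolding q_def using P by (intro tendsto_intros) auto
  qed
  ultimately have "B * (1 ^ l / P) powr p \<le> 1"
    using gbinomial_powr_not_summable[OF assms(1)]
    by (intro not_summable_weighted_bound[of "\<lambda>n. g n powr p"]) (auto simp: g_def a_def)
  then have "B \<le> P powr p"
    using P by (simp add: powr_divide field_simps)
  moreover have "P = pochhammer ((p - 1) / p) l"
    using assms(1) by (simp add: P_def a_def diff_divide_distrib)
  ultimately show ?thesis
    by (simp add: hardy_const_def)
qed

section \<open>Reindexing the sums over \<open>n \<ge> l\<close> by \<open>n = m + l\<close>\<close>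

lemma nabla_funpow_shift:
  assumes "\<forall>n<l. u n = 0"
  shows "(\<forall>n<l. (nabla ^^ k) u n = 0) \<and> (\<forall>m. (nabla ^^ k) u (m + l) = (nabla ^^ k) (\<lambda>m. u (m + l)) m)"
proof (induction k)
  case (Suc k)
  let ?v = "(nabla ^^ k) u" and ?w = "(nabla ^^ k) (\<lambda>m. u (m + l))"
  have z: "?v n = 0" if "n < l" for n
    using Suc that by blast
  have e: "?v (m + l) = ?w m" for m
    using Suc by blast
  have "nabla ?v n = 0" if "n < l" for n
    using that by (auto simp: nabla_def z split: nat.split)
  moreover have "nabla ?v (m + l) = nabla ?w m" for m
  proof (cases m)
    \<comment> \<open>For \<open>l > 0\<close> the zero at index \<open>l - 1\<close> takes over the
      role of the convention at index \<open>-1\<close>.\<close>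
    case 0
    then show ?thesis
      using e[of 0] z by (auto simp: nabla_def split: nat.split)
  next
    case (Suc i)
    then show ?thesis
      using e[of m] e[of i] by (simp add: nabla_def)
  qed
  ultimately show ?case by simp
qed (use assms in simp)

lemma infsum_atLeast_eq_sum:
  fixes f :: "nat \<Rightarrow> real"
  assumes "\<And>m. M \<le> m \<Longrightarrow> f (m + l) = 0"
  shows "(\<Sum>\<^sub>\<infinity>n\<in>{l..}. f n) = (\<Sum>m<M. f (m + l))"
proof -
  have z: "f n = 0" if "l + M \<le> n" for n
    using assms[of "n - l"] that by simp
  have "(\<Sum>\<^sub>\<infinity>n\<in>{l..}. f n) = (\<Sum>\<^sub>\<infinity>n\<in>{l..<l + M}. f n)"
    by (rule infsum_cong_neutral) (auto simp: z)
  also have "\<dots> = (\<Sum>m<M. f (m + l))"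
    by (simp add: sum.shift_bounds_nat_ivl[of f 0 l M, simplified] add.commute lessThan_atLeast0)
  finally show ?thesis .
qed

lemma admissible_sums:
  assumes "u \<in> admissible l"
  shows "\<exists>R. \<forall>M\<ge>R.
      (\<Sum>\<^sub>\<infinity>n\<in>{l..}. cmod ((nabla ^^ l) u n) powr p)
        = (\<Sum>m<M. cmod ((nabla ^^ l) (\<lambda>m. u (m + l)) m) powr p)
      \<and> (\<Sum>\<^sub>\<infinity>n\<in>{l..}. cmod (u n) powr p / real n powr (real l * p))
        = (\<Sum>m<M. cmod (u (m + l)) powr p / real (m + l) powr (real l * p))"
proof -
  have "finite ({n. u n \<noteq> 0} \<union> {n. (nabla ^^ l) u n \<noteq> 0})"
    using assms finite_support_nabla_funpow by (auto simp: admissible_def)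
  then obtain R where R: "{n. u n \<noteq> 0} \<union> {n. (nabla ^^ l) u n \<noteq> 0} \<subseteq> {..<R}"
    using finite_nat_iff_bounded by blast
  have z: "u n = 0" "(nabla ^^ l) u n = 0" if "R \<le> n" for n
    using R that by (auto simp: subset_eq not_le[symmetric])
  have shift: "(nabla ^^ l) (\<lambda>m. u (m + l)) m = (nabla ^^ l) u (m + l)" for m
    using assms nabla_funpow_shift[of l u l] by (auto simp: admissible_def)
  show ?thesis
  proof (intro exI allI impI conjI)
    fix M assume "R \<le> M"
    then show "(\<Sum>\<^sub>\<infinity>n\<in>{l..}. cmod ((nabla ^^ l) u n) powr p)
      = (\<Sum>m<M. cmod ((nabla ^^ l) (\<lambda>m. u (m + l)) m) powr p)"
      unfolding shift by (intro infsum_atLeast_eq_sum) (simp add: z)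
    from \<open>R \<le> M\<close> show "(\<Sum>\<^sub>\<infinity>n\<in>{l..}. cmod (u n) powr p / real n powr (real l * p))
      = (\<Sum>m<M. cmod (u (m + l)) powr p / real (m + l) powr (real l * p))"
      by (intro infsum_atLeast_eq_sum) (simp add: z)
  qed
qed

theorem theorem1:
  fixes l :: nat and p :: real
  assumes "1 \<le> l" and "1 < p"
  shows "(\<forall>u \<in> admissible l.
            (\<Sum>\<^sub>\<infinity>n\<in>{l..}. cmod ((nabla ^^ l) u n) powr p)
              \<ge> hardy_const l p * (\<Sum>\<^sub>\<infinity>n\<in>{l..}. cmod (u n) powr p / real n powr (real l * p)))
       \<and> (\<forall>B::real.
            (\<forall>u \<in> admissible l.
               (\<Sum>\<^sub>\<infinity>n\<in>{l..}. cmod ((nabla ^^ l) u n) powr p)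
                 \<ge> B * (\<Sum>\<^sub>\<infinity>n\<in>{l..}. cmod (u n) powr p / real n powr (real l * p)))
            \<longrightarrow> B \<le> hardy_const l p)"
proof (intro conjI ballI allI impI)
  fix u assume "u \<in> admissible l"
  from admissible_sums[OF this, of p] obtain R where R:
    "(\<Sum>\<^sub>\<infinity>n\<in>{l..}. cmod ((nabla ^^ l) u n) powr p)
      = (\<Sum>m<R. cmod ((nabla ^^ l) (\<lambda>m. u (m + l)) m) powr p)"
    "(\<Sum>\<^sub>\<infinity>n\<in>{l..}. cmod (u n) powr p / real n powr (real l * p))
      = (\<Sum>m<R. cmod (u (m + l)) powr p / real (m + l) powr (real l * p))"
    by blast
  show "hardy_const l p * (\<Sum>\<^sub>\<infinity>n\<in>{l..}. cmod (u n) powr p / real n powr (real l * p))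
      \<le> (\<Sum>\<^sub>\<infinity>n\<in>{l..}. cmod ((nabla ^^ l) u n) powr p)"
    unfolding R
    by (rule nabla_funpow_Hardy_shifted[OF assms(2)])
next
  fix B :: real
  assume B: "\<forall>u \<in> admissible l. B * (\<Sum>\<^sub>\<infinity>n\<in>{l..}. cmod (u n) powr p / real n powr (real l * p))
      \<le> (\<Sum>\<^sub>\<infinity>n\<in>{l..}. cmod ((nabla ^^ l) u n) powr p)"
  show "B \<le> hardy_const l p"
  proof (cases "0 \<le> B")
    case True
    have ineq: "\<exists>R. \<forall>M. B * (\<Sum>m<M. cmod (t m) powr p / real (m + l) powr (real l * p))
         \<le> (\<Sum>m<R. cmod ((nabla ^^ l) t m) powr p)" if t: "finite {n. t n \<noteq> 0}" for t
    proof -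
      define u where "u n = (if n < l then 0 else t (n - l))" for n
      have "{n. u n \<noteq> 0} \<subseteq> (\<lambda>m. m + l) ` {n. t n \<noteq> 0}"
      proof
        fix n assume "n \<in> {n. u n \<noteq> 0}"
        then have "n = (n - l) + l" "t (n - l) \<noteq> 0"
          by (auto simp: u_def split: if_splits)
        then show "n \<in> (\<lambda>m. m + l) ` {n. t n \<noteq> 0}" by blast
      qed
      then have "finite {n. u n \<noteq> 0}"
        using t finite_surj by blast
      then have u: "u \<in> admissible l"
        by (simp add: admissible_def u_def)
      have ut: "u (m + l) = t m" for m
        by (simp add: u_def)
      obtain R where R: "\<forall>M\<ge>R.
          (\<Sum>\<^sub>\<infinity>n\<in>{l..}. cmod ((nabla ^^ l) u n) powr p)
            = (\<Sum>m<M. cmod ((nabla ^^ l) t m) powr p)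
          \<and> (\<Sum>\<^sub>\<infinity>n\<in>{l..}. cmod (u n) powr p / real n powr (real l * p))
            = (\<Sum>m<M. cmod (t m) powr p / real (m + l) powr (real l * p))"
        using admissible_sums[OF u, of p] unfolding ut by (elim exE)
      have "B * (\<Sum>m<M. cmod (t m) powr p / real (m + l) powr (real l * p))
         \<le> (\<Sum>m<R. cmod ((nabla ^^ l) t m) powr p)" for M
      proof -
        \<comment> \<open>Lengthening the range to \<open>max R M\<close> gives the complete left
          sum, which uses \<open>0 \<le> B\<close>; the complete gradient sum is already reached at
          \<open>R\<close>.\<close>
        have "B * (\<Sum>m<M. cmod (t m) powr p / real (m + l) powr (real l * p))
            \<le> B * (\<Sum>m<max R M. cmod (t m) powr p / real (m + l) powr (real l * p))"
          using True by (intro mult_left_mono sum_mono2) auto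
        also have "\<dots> \<le> (\<Sum>m<R. cmod ((nabla ^^ l) t m) powr p)"
          using bspec[OF B u] R[rule_format, of R] R[rule_format, of "max R M"] by auto
        finally show ?thesis .
      qed
      then show ?thesis by blast
    qed
    have "0 < l" using assms(1) by simp
    from assms(2) this True show ?thesis
    proof (rule Hardy_constant_optimal)
      fix M s
      assume s: "\<And>n. M \<le> n \<Longrightarrow> (nabla ^^ l) s n = 0"
      show "B * (\<Sum>m<M. cmod (s m) powr p / real (m + l) powr (real l * p))
          \<le> (\<Sum>m<M. cmod ((nabla ^^ l) s m) powr p)"
        by (rule Hardy_extension[OF assms(2) True]) (rule ineq, assumption, rule s)
    qed
  next
    case False
    have "0 \<le> hardy_const l p"
      by (simp add: hardy_const_def)
    with False show ?thesis by linarith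
  qed
qed

end
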